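(* The following two problems are decidable. (1) Given an invertible synchronizing Mealy automaton $\mathcal{M}=(Q,A,\delta,\lambda)$, decide whether $\mathcal{M}$ is a reset Mealy automaton. (2) Given an invertible reset Mealy automaton $\mathcal{M}=(Q,A,\delta,\lambda)$ and states $q\neq p$ in $Q$, decide whether or not the modified state functions satisfy $\widetilde{\lambda_q}=\widetilde{\lambda_p}$.
   Context: A (finite state) Mealy automaton is a tuple $\mathcal{M}=(Q,A,\delta,\lambda)$ with $Q$ a finite set of states, $A$ a finite alphabet, $\delta:Q\times A\to Q$ and $\lambda:Q\times A\to A$. Write $q\cdot a=\delta(q,a)$, $q\circ a=\lambda(q,a)$, extended to words by $q\cdot(ua)=(q\cdot u)\cdot a$ and $q\circ(ua)=(q\circ u)((q\cdot u)\circ a)$; $Q\cdot u=\{q\cdot u:q\in Q\}$; $\mathcal{M}_q:A^*\to A^*$, $\mathcal{M}_q(u)=q\circ u$. $\mathcal{M}$ is invertible if each map $a\mapsto\lambda(q,a)$ is a permutation of $A$. $\mathrm{Syn}(\mathcal{M})=\{u\in A^*:|Q\cdot u|=1\}$; $\mathcal{M}$ is synchronizing if $\mathrm{Syn}(\mathcal{M})\ne\emptyset$, and reset if it is synchronizing and $\mathcal{M}_q(\mathrm{Syn}(\mathcal{M}))\subseteq\mathrm{Syn}(\mathcal{M})$ for every $q\in Q$. For a reset $\mathcal{M}$, the modified state function $\widetilde{\lambda_q}:\mathrm{Syn}(\mathcal{M})\to Q$ sends $u$ to the unique element of $Q\cdot(q\circ u)$. *)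

theory Defs
  imports Complex_Main "HOL-Library.FuncSet" "HOL-Library.Nat_Bijection"
begin

section \<open>Mealy automata\<close>

record ('q, 'a) mealy =
  states :: "'q set"
  alphabet :: "'a set"
  trans_fun :: "'q \<Rightarrow> 'a \<Rightarrow> 'q"
  out_fun :: "'q \<Rightarrow> 'a \<Rightarrow> 'a"

definition mealy_automaton :: "('q, 'a) mealy \<Rightarrow> bool" where
  "mealy_automaton M \<longleftrightarrow>
     finite (states M) \<and> finite (alphabet M) \<and>
     (\<forall>q\<in>states M. \<forall>a\<in>alphabet M. trans_fun M q a \<in> states M) \<and>
     (\<forall>q\<in>states M. \<forall>a\<in>alphabet M. out_fun M q a \<in> alphabet M)"

text \<open>The actions of words are defined by recursion on the first letter; the equations for
  appending a last letter are \<open>state_after_append_letter\<close> and \<open>out_word_append_letter\<close>.\<close>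

primrec state_after :: "('q, 'a) mealy \<Rightarrow> 'q \<Rightarrow> 'a list \<Rightarrow> 'q" where
  "state_after M q [] = q"
| "state_after M q (a # u) = state_after M (trans_fun M q a) u"

primrec out_word :: "('q, 'a) mealy \<Rightarrow> 'q \<Rightarrow> 'a list \<Rightarrow> 'a list" where
  "out_word M q [] = []"
| "out_word M q (a # u) = out_fun M q a # out_word M (trans_fun M q a) u"

lemma state_after_append_letter: "state_after M q (u @ [a]) = trans_fun M (state_after M q u) a"
  by (induction u arbitrary: q) auto

lemma out_word_append_letter:
  "out_word M q (u @ [a]) = out_word M q u @ [out_fun M (state_after M q u) a]"
  by (induction u arbitrary: q) auto

definition states_after :: "('q, 'a) mealy \<Rightarrow> 'a list \<Rightarrow> 'q set" where
  "states_after M u = (\<lambda>q. state_after M q u) ` states M"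

definition invertible_mealy :: "('q, 'a) mealy \<Rightarrow> bool" where
  "invertible_mealy M \<longleftrightarrow> (\<forall>q\<in>states M. bij_betw (out_fun M q) (alphabet M) (alphabet M))"

definition Syn :: "('q, 'a) mealy \<Rightarrow> 'a list set" where
  "Syn M = {u \<in> lists (alphabet M). card (states_after M u) = 1}"

definition synchronizing :: "('q, 'a) mealy \<Rightarrow> bool" where
  "synchronizing M \<longleftrightarrow> Syn M \<noteq> {}"

definition reset_mealy :: "('q, 'a) mealy \<Rightarrow> bool" where
  "reset_mealy M \<longleftrightarrow> synchronizing M \<and> (\<forall>q\<in>states M. out_word M q ` Syn M \<subseteq> Syn M)"

text \<open>Restricting to \<open>Syn M\<close> makes equality of these HOL functions the same as equality
  of functions with domain \<open>Syn M\<close>.\<close>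

definition modified_state_fun :: "('q, 'a) mealy \<Rightarrow> 'q \<Rightarrow> 'a list \<Rightarrow> 'q" where
  "modified_state_fun M q = (\<lambda>u\<in>Syn M. the_elem (states_after M (out_word M q u)))"


section \<open>Decidability\<close>

text \<open>Total recursive functions: the least class containing the zero, successor and projection
  functions and closed under composition, primitive recursion and minimization of regular
  functions. In \<open>recursive_fun n f\<close> only the values of \<open>f\<close> on lists of length \<open>n\<close> are
  meaningful. In a primitive recursion the recursion argument comes first.\<close>

inductive recursive_fun :: "nat \<Rightarrow> (nat list \<Rightarrow> nat) \<Rightarrow> bool" where
  zero: "recursive_fun n (\<lambda>xs. 0)"
| succ: "recursive_fun 1 (\<lambda>xs. Suc (xs ! 0))"
| proj: "i < n \<Longrightarrow> recursive_fun n (\<lambda>xs. xs ! i)"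
| comp: "recursive_fun (length gs) f \<Longrightarrow> (\<forall>g\<in>set gs. recursive_fun n g) \<Longrightarrow>
     recursive_fun n (\<lambda>xs. f (map (\<lambda>g. g xs) gs))"
| prim_rec: "recursive_fun n f \<Longrightarrow> recursive_fun (Suc (Suc n)) g \<Longrightarrow>
     recursive_fun (Suc n)
       (\<lambda>xs. rec_nat (f (tl xs)) (\<lambda>k r. g (k # r # tl xs)) (hd xs))"
| minim: "recursive_fun (Suc n) f \<Longrightarrow> (\<forall>xs. length xs = n \<longrightarrow> (\<exists>y. f (y # xs) = 0)) \<Longrightarrow>
     recursive_fun n (\<lambda>xs. LEAST y. f (y # xs) = 0)"

text \<open>The problem of deciding \<open>P\<close> for instances in \<open>I\<close>, given through the coding \<open>enc\<close>:
  one algorithm must answer correctly on all instances, and nothing is required of its answer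
  on a number that is not the code of an instance.\<close>

definition decidable_problem :: "('i \<Rightarrow> nat) \<Rightarrow> 'i set \<Rightarrow> ('i \<Rightarrow> bool) \<Rightarrow> bool" where
  "decidable_problem enc I P \<longleftrightarrow>
     (\<exists>f. recursive_fun 1 f \<and> (\<forall>x\<in>I. f [enc x] = (if P x then 1 else 0)))"

text \<open>As inputs of an algorithm, automata have natural numbers as names of states and letters.
  The code lists the states, the letters, and the rows \<open>(q, a, \<delta>(q,a), \<lambda>(q,a))\<close> of the table.\<close>

definition mealy_rows :: "(nat, nat) mealy \<Rightarrow> nat list list" where
  "mealy_rows M =
     map (\<lambda>(q, a). [q, a, trans_fun M q a, out_fun M q a])
       (List.product (sorted_list_of_set (states M)) (sorted_list_of_set (alphabet M)))"

definition encode_mealy :: "(nat, nat) mealy \<Rightarrow> nat" where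
  "encode_mealy M =
     list_encode [list_encode (sorted_list_of_set (states M)),
                  list_encode (sorted_list_of_set (alphabet M)),
                  list_encode (map list_encode (mealy_rows M))]"

definition encode_mealy_states :: "(nat, nat) mealy \<times> nat \<times> nat \<Rightarrow> nat" where
  "encode_mealy_states = (\<lambda>(M, q, p). list_encode [encode_mealy M, q, p])"

text \<open>An automaton is determined by its code, up to the irrelevant values of the two functions
  outside \<open>Q \<times> A\<close>.\<close>

lemma encode_mealy_determines:
  assumes M: "mealy_automaton M" and N: "mealy_automaton N"
    and eq: "encode_mealy M = encode_mealy N"
  shows "states M = states N" and "alphabet M = alphabet N"
    and "\<And>q a. q \<in> states M \<Longrightarrow> a \<in> alphabet M \<Longrightarrow>
           trans_fun M q a = trans_fun N q a \<and> out_fun M q a = out_fun N q a"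
proof -
  have fin: "finite (states M)" "finite (alphabet M)" "finite (states N)" "finite (alphabet N)"
    using M N by (auto simp: mealy_automaton_def)
  have eqs: "sorted_list_of_set (states M) = sorted_list_of_set (states N)"
    "sorted_list_of_set (alphabet M) = sorted_list_of_set (alphabet N)"
    "map list_encode (mealy_rows M) = map list_encode (mealy_rows N)"
    using eq by (auto simp: encode_mealy_def list_encode_eq)
  show s: "states M = states N" and a: "alphabet M = alphabet N"
    using eqs(1,2) fin by (metis set_sorted_list_of_set)+
  have "mealy_rows M = mealy_rows N"
    using eqs(3) inj_list_encode by (simp add: inj_map_eq_map)
  then show "trans_fun M q a = trans_fun N q a \<and> out_fun M q a = out_fun N q a"
    if "q \<in> states M" "a \<in> alphabet M" for q a
    using that fin unfolding mealy_rows_def s a by auto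
qed

end

(* Every word u acts on pairs of states by (x, y) |-> (x.u, y.(x o u)), and the action of a
   concatenation is the composition of the actions. There are only (n^2)^(n^2) self-maps of Q x Q,
   so every action is realized by a word shorter than that. Whether u is synchronizing, whether
   x o u is synchronizing, and the value at u of a modified state function can all be read off this
   action; a counterexample to either property can therefore be searched for among the words of
   bounded length, which amounts to a bounded search over the codes of words. *)

theory Submission
  imports Defs
begin

section \<open>Closure properties of total recursive functions\<close>

text \<open>The class \<open>recursive_fun n\<close> is sensitive to the junk values on lists of length other than
  \<open>n\<close>; the following class is not.\<close>

definition computable :: "nat \<Rightarrow> (nat list \<Rightarrow> nat) \<Rightarrow> bool" where
  "computable n f \<longleftrightarrow> (\<exists>g. recursive_fun n g \<and> (\<forall>xs. length xs = n \<longrightarrow> g xs = f xs))"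

definition decidable :: "nat \<Rightarrow> (nat list \<Rightarrow> bool) \<Rightarrow> bool" where
  "decidable n P \<longleftrightarrow> computable n (\<lambda>xs. if P xs then 1 else 0)"

named_theorems computable_intros

section \<open>Transfer, composition and recursion rules\<close>

lemma computable_cong:
  assumes "computable n f" "\<And>xs. length xs = n \<Longrightarrow> f xs = g xs"
  shows "computable n g"
  using assms unfolding computable_def by metis

lemma computable_recursive_fun: "recursive_fun n f \<Longrightarrow> computable n f"
  unfolding computable_def by blast

lemma computable_comp:
  assumes F: "computable (length gs) F" and gs: "\<And>g. g \<in> set gs \<Longrightarrow> computable n g"
  shows "computable n (\<lambda>xs. F (map (\<lambda>g. g xs) gs))"
proof -
  obtain F' where F': "recursive_fun (length gs) F'" "\<And>xs. length xs = length gs \<Longrightarrow> F' xs = F xs"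
    using F unfolding computable_def by blast
  obtain h where h: "\<And>g. g \<in> set gs \<Longrightarrow> recursive_fun n (h g)"
    "\<And>g xs. g \<in> set gs \<Longrightarrow> length xs = n \<Longrightarrow> h g xs = g xs"
    using gs unfolding computable_def by metis
  have "recursive_fun n (\<lambda>xs. F' (map (\<lambda>g. g xs) (map h gs)))"
    by (rule recursive_fun.comp) (use F' h in auto)
  moreover have "F' (map (\<lambda>g. g xs) (map h gs)) = F (map (\<lambda>g. g xs) gs)" if "length xs = n" for xs
  proof -
    have "map (\<lambda>g. g xs) (map h gs) = map (\<lambda>g. g xs) gs"
      using h(2) that by auto
    then show ?thesis using F'(2) by (metis length_map)
  qed
  ultimately show ?thesis unfolding computable_def by blast
qed

lemma computable_proj [computable_intros]: "i < n \<Longrightarrow> computable n (\<lambda>xs. xs ! i)"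
  by (intro computable_recursive_fun recursive_fun.proj)

text \<open>Recursions, minima and bounded quantifiers put their bound variables in front of the
  argument list, so outer arguments are reached through repeated \<open>tl\<close>. Four levels
  cover the deepest nesting below, the four quantifiers of \<open>code_reset\<close>.\<close>

lemma computable_proj_tl [computable_intros]:
  "Suc i < n \<Longrightarrow> computable n (\<lambda>xs. tl xs ! i)"
  "Suc (Suc i) < n \<Longrightarrow> computable n (\<lambda>xs. tl (tl xs) ! i)"
  "Suc (Suc (Suc i)) < n \<Longrightarrow> computable n (\<lambda>xs. tl (tl (tl xs)) ! i)"
  "Suc (Suc (Suc (Suc i))) < n \<Longrightarrow> computable n (\<lambda>xs. tl (tl (tl (tl xs))) ! i)"
  by (rule computable_cong, rule computable_proj, assumption, simp add: nth_tl)+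

text \<open>This rule and its variants for more arguments reduce a closure property to the case
  where the arguments are plain projections.\<close>

lemma computable_comp1:
  assumes "computable 1 (\<lambda>xs. F (xs ! 0))" "computable n f"
  shows "computable n (\<lambda>xs. F (f xs))"
  using computable_comp[of "[f]" "\<lambda>xs. F (xs ! 0)" n] assms by simp

lemma computable_comp2:
  assumes "computable 2 (\<lambda>xs. F (xs ! 0) (xs ! 1))" "computable n f" "computable n g"
  shows "computable n (\<lambda>xs. F (f xs) (g xs))"
  using computable_comp[of "[f, g]" "\<lambda>xs. F (xs ! 0) (xs ! 1)" n] assms
  by (auto simp: numeral_eq_Suc)

lemma computable_comp3:
  assumes "computable 3 (\<lambda>xs. F (xs ! 0) (xs ! 1) (xs ! 2))"
    "computable n f" "computable n g" "computable n h"
  shows "computable n (\<lambda>xs. F (f xs) (g xs) (h xs))"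
  using computable_comp[of "[f, g, h]" "\<lambda>xs. F (xs ! 0) (xs ! 1) (xs ! 2)" n] assms
  by (auto simp: numeral_eq_Suc)

lemma computable_comp4:
  assumes "computable 4 (\<lambda>xs. F (xs ! 0) (xs ! 1) (xs ! 2) (xs ! 3))"
    "computable n f" "computable n g" "computable n h" "computable n k"
  shows "computable n (\<lambda>xs. F (f xs) (g xs) (h xs) (k xs))"
  using computable_comp[of "[f, g, h, k]" "\<lambda>xs. F (xs ! 0) (xs ! 1) (xs ! 2) (xs ! 3)" n] assms
  by (auto simp: numeral_eq_Suc)

lemma computable_comp5:
  assumes "computable 5 (\<lambda>xs. F (xs ! 0) (xs ! 1) (xs ! 2) (xs ! 3) (xs ! 4))"
    "computable n f" "computable n g" "computable n h" "computable n k" "computable n l"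
  shows "computable n (\<lambda>xs. F (f xs) (g xs) (h xs) (k xs) (l xs))"
  using computable_comp[of "[f, g, h, k, l]"
      "\<lambda>xs. F (xs ! 0) (xs ! 1) (xs ! 2) (xs ! 3) (xs ! 4)" n] assms
  by (auto simp: numeral_eq_Suc)

lemma computable_drop:
  assumes F: "computable n F"
  shows "computable (k + n) (\<lambda>xs. F (drop k xs))"
proof -
  let ?gs = "map (\<lambda>i xs. xs ! (k + i)) [0..<n]"
  have eq: "map (\<lambda>g. g xs) ?gs = drop k xs" if "length xs = k + n" for xs
    using that by (intro nth_equalityI) auto
  have "computable (k + n) (\<lambda>xs. F (map (\<lambda>g. g xs) ?gs))"
    by (rule computable_comp) (use F computable_proj in auto)
  then show ?thesis by (rule computable_cong) (simp only: eq)
qed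

text \<open>Substitutes one computed value for the first \<open>k\<close> arguments. The cases
  \<open>k\<close> = 0, 1, 2 serve primitive recursion, quantifiers over coded lists and bounded
  quantifiers.\<close>

lemma computable_Cons_drop:
  assumes F: "computable (Suc n) F" and b: "computable (k + n) b"
  shows "computable (k + n) (\<lambda>xs. F (b xs # drop k xs))"
proof -
  let ?gs = "b # map (\<lambda>i xs. xs ! (k + i)) [0..<n]"
  have "computable (k + n) (\<lambda>xs. F (map (\<lambda>g. g xs) ?gs))"
    by (rule computable_comp) (use F b computable_proj in auto)
  moreover have "map (\<lambda>g. g xs) ?gs = b xs # drop k xs" if "length xs = k + n" for xs
    using that by (intro nth_equalityI) (auto simp: nth_Cons')
  ultimately show ?thesis by (auto elim: computable_cong)
qed

lemma computable_rec_nat [computable_intros]: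
  assumes "computable n a" "computable (Suc (Suc n)) (\<lambda>ys. g (ys ! 0) (ys ! 1) (tl (tl ys)))"
    "computable n b"
  shows "computable n (\<lambda>xs. rec_nat (a xs) (\<lambda>k r. g k r xs) (b xs))"
proof -
  obtain a' where a': "recursive_fun n a'" "\<And>xs. length xs = n \<Longrightarrow> a' xs = a xs"
    using assms(1) unfolding computable_def by blast
  obtain g' where g': "recursive_fun (Suc (Suc n)) g'"
    "\<And>ys. length ys = Suc (Suc n) \<Longrightarrow> g' ys = g (ys ! 0) (ys ! 1) (tl (tl ys))"
    using assms(2) unfolding computable_def by blast
  \<comment> \<open>Primitive recursion takes its recursion argument first, so \<open>b xs\<close>
    is prepended to the parameters.\<close>
  have "computable n (\<lambda>xs. rec_nat (a' (tl (b xs # xs)))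
      (\<lambda>k r. g' (k # r # tl (b xs # xs))) (hd (b xs # xs)))"
    using computable_Cons_drop[where k = 0] assms(3)
      computable_recursive_fun[OF recursive_fun.prim_rec[OF a'(1) g'(1)]] by fastforce
  then show ?thesis
    by (rule computable_cong) (simp add: a' g')
qed

section \<open>Arithmetic functions\<close>

lemma computable_Suc [computable_intros]: "computable n f \<Longrightarrow> computable n (\<lambda>xs. Suc (f xs))"
  by (rule computable_comp1[of Suc, OF computable_recursive_fun[OF recursive_fun.succ]])

lemma computable_const [computable_intros]: "computable n (\<lambda>xs. c)"
  by (induction c) (auto intro: computable_recursive_fun recursive_fun.zero computable_Suc)

lemma computable_add [computable_intros]:
  assumes "computable n f" "computable n g"
  shows "computable n (\<lambda>xs. f xs + g xs)"
proof (rule computable_comp2[OF _ assms])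
  have "rec_nat b (\<lambda>k r. Suc r) a = a + b" for a b :: nat
    by (induction a) auto
  moreover have "computable 2 (\<lambda>xs. rec_nat (xs ! 1) (\<lambda>k r. Suc r) (xs ! 0))"
    by (intro computable_intros) simp_all
  ultimately show "computable 2 (\<lambda>xs. xs ! 0 + xs ! 1)" by simp
qed

lemma computable_mult [computable_intros]:
  assumes "computable n f" "computable n g"
  shows "computable n (\<lambda>xs. f xs * g xs)"
proof (rule computable_comp2[OF _ assms])
  have "rec_nat 0 (\<lambda>k r. r + b) a = a * b" for a b :: nat
    by (induction a) auto
  moreover have "computable 2 (\<lambda>xs. rec_nat 0 (\<lambda>k r. r + xs ! 1) (xs ! 0))"
    by (intro computable_intros) simp_all
  ultimately show "computable 2 (\<lambda>xs. xs ! 0 * xs ! 1)" by simp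
qed

lemma computable_power [computable_intros]:
  assumes "computable n f" "computable n g"
  shows "computable n (\<lambda>xs. f xs ^ g xs)"
proof (rule computable_comp2[OF _ assms])
  have "rec_nat 1 (\<lambda>k r. a * r) b = a ^ b" for a b :: nat
    by (induction b) auto
  moreover have "computable 2 (\<lambda>xs. rec_nat 1 (\<lambda>k r. xs ! 0 * r) (xs ! 1))"
    by (intro computable_intros) simp_all
  ultimately show "computable 2 (\<lambda>xs. xs ! 0 ^ xs ! 1)" by simp
qed

lemma computable_diff [computable_intros]:
  assumes "computable n f" "computable n g"
  shows "computable n (\<lambda>xs. f xs - g xs)"
proof (rule computable_comp2[OF _ assms])
  \<comment> \<open>A recursion whose step returns its index is the predecessor; truncated
    subtraction iterates it.\<close>
  have pred: "rec_nat 0 (\<lambda>k r. k) a = a - 1" for a :: nat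
    by (cases a) auto
  have "rec_nat a (\<lambda>k r. rec_nat 0 (\<lambda>k r. k) r) b = a - b" for a b :: nat
    by (induction b) (auto simp: pred)
  moreover have "computable 2 (\<lambda>xs. rec_nat (xs ! 0) (\<lambda>k r. rec_nat 0 (\<lambda>k r. k) r) (xs ! 1))"
    by (intro computable_intros) simp_all
  ultimately show "computable 2 (\<lambda>xs. xs ! 0 - xs ! 1)" by simp
qed

section \<open>Decidable predicates, bounded search and minimization\<close>

lemma decidable_not [computable_intros]:
  assumes "decidable n P" shows "decidable n (\<lambda>xs. \<not> P xs)"
proof -
  have "computable n (\<lambda>xs. 1 - (if P xs then 1 else 0))"
    using assms unfolding decidable_def by (intro computable_intros)
  then show ?thesis unfolding decidable_def by (rule computable_cong) simp
qed

lemma decidable_conj [computable_intros]: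
  assumes "decidable n P" "decidable n Q" shows "decidable n (\<lambda>xs. P xs \<and> Q xs)"
proof -
  have "computable n (\<lambda>xs. (if P xs then 1 else 0) * (if Q xs then 1 else 0))"
    using assms unfolding decidable_def by (intro computable_intros)
  then show ?thesis unfolding decidable_def by (rule computable_cong) simp
qed

lemma decidable_disj [computable_intros]:
  assumes "decidable n P" "decidable n Q" shows "decidable n (\<lambda>xs. P xs \<or> Q xs)"
  using decidable_not[OF decidable_conj[OF assms[THEN decidable_not]]] by simp

lemma decidable_le [computable_intros]:
  assumes "computable n f" "computable n g" shows "decidable n (\<lambda>xs. f xs \<le> g xs)"
proof -
  \<comment> \<open>Truncated subtraction gives 0 exactly when
    \<open>f xs \<le> g xs\<close>.\<close>
  have "computable n (\<lambda>xs. 1 - (f xs - g xs))"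
    using assms by (intro computable_intros)
  then show ?thesis unfolding decidable_def by (rule computable_cong) simp
qed

lemma decidable_eq [computable_intros]:
  assumes "computable n f" "computable n g" shows "decidable n (\<lambda>xs. f xs = g xs)"
  unfolding order_eq_iff using assms by (intro computable_intros)

lemma decidable_bex [computable_intros]:
  assumes "computable n b" "decidable (Suc n) (\<lambda>ys. P (ys ! 0) (tl ys))"
  shows "decidable n (\<lambda>xs. \<exists>y<b xs. P y xs)"
proof -
  let ?p = "\<lambda>k xs. if P k xs then 1 else (0 :: nat)"
  have p: "computable (Suc n) (\<lambda>ys. ?p (ys ! 0) (tl ys))"
    using assms(2) unfolding decidable_def .
  \<comment> \<open>In a recursion step the accumulator sits between the index and the parameters;
    the predicate skips it.\<close>
  have "computable (Suc (Suc n)) (\<lambda>ys. ?p (ys ! 0) (tl (tl ys)))"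
    using computable_Cons_drop[OF p, of 2 "\<lambda>ys. ys ! 0"] computable_proj[of 0 "Suc (Suc n)"]
    by (simp add: numeral_2_eq_2 drop_Suc)
  \<comment> \<open>\<open>1 - (1 - s)\<close> caps \<open>s\<close> at 1, so the accumulator is the
    disjunction of the values seen so far.\<close>
  then have "computable (Suc (Suc n)) (\<lambda>ys. 1 - (1 - (ys ! 1 + ?p (ys ! 0) (tl (tl ys)))))"
    by (intro computable_intros) simp_all
  then have "computable n (\<lambda>xs. rec_nat 0 (\<lambda>k r. 1 - (1 - (r + ?p k xs))) (b xs))"
    by (intro computable_rec_nat assms computable_const)
  moreover have "rec_nat 0 (\<lambda>k r. 1 - (1 - (r + ?p k xs))) m = (if \<exists>y<m. P y xs then 1 else 0)"
    for xs m
    by (induction m) (auto simp: less_Suc_eq)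
  ultimately show ?thesis unfolding decidable_def by simp
qed

text \<open>Minimization looks for a zero, so it is applied to the characteristic function of the
  negation. The search must succeed for all parameters, codes or not.\<close>

lemma computable_Least [computable_intros]:
  assumes "decidable (Suc n) (\<lambda>ys. P (ys ! 0) (tl ys))"
    and ex: "\<And>xs. length xs = n \<Longrightarrow> \<exists>y. P y xs"
  shows "computable n (\<lambda>xs. LEAST y. P y xs)"
proof -
  obtain f where f: "recursive_fun (Suc n) f"
    "\<And>ys. length ys = Suc n \<Longrightarrow> f ys = (if \<not> P (ys ! 0) (tl ys) then 1 else 0)"
    using decidable_not[OF assms(1)] unfolding decidable_def computable_def by blast
  have eq: "f (y # xs) = 0 \<longleftrightarrow> P y xs" if "length xs = n" for xs y
    using f(2)[of "y # xs"] that by simp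
  have "recursive_fun n (\<lambda>xs. LEAST y. f (y # xs) = 0)"
    using f(1) ex eq by (intro recursive_fun.minim) auto
  then show ?thesis
    by (rule computable_cong[OF computable_recursive_fun]) (simp add: eq)
qed


section \<open>Codes of pairs and lists\<close>

lemma computable_prod_encode [computable_intros]:
  assumes "computable n f" "computable n g"
  shows "computable n (\<lambda>xs. prod_encode (f xs, g xs))"
proof -
  have tri: "triangle m = rec_nat 0 (\<lambda>k r. r + Suc k) m" for m
    by (induction m) auto
  have "computable n (\<lambda>xs. triangle (f xs + g xs))"
    by (rule computable_comp1[of triangle], unfold tri, intro computable_intros)
      (use assms in \<open>auto intro: computable_intros\<close>)
  then show ?thesis
    unfolding prod_encode_def prod.case using assms by (intro computable_intros)
qed

text \<open>Each component is found by minimization; the search for the other one can be bounded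
  because neither component exceeds the code of the pair.\<close>

lemma computable_prod_decode [computable_intros]:
  assumes "computable n f"
  shows "computable n (\<lambda>xs. fst (prod_decode (f xs)))" "computable n (\<lambda>xs. snd (prod_decode (f xs)))"
proof -
  have pr: "prod_encode (x, y) = z \<longleftrightarrow> x = fst (prod_decode z) \<and> y = snd (prod_decode z)" for x y z
    by (metis prod.collapse prod.inject prod_decode_inverse prod_encode_inverse)
  have le: "fst (prod_decode z) < Suc z" "snd (prod_decode z) < Suc z" for z
    by (metis le_imp_less_Suc le_prod_encode_1 le_prod_encode_2 prod.collapse prod_decode_inverse)+
  have "(LEAST x. \<exists>y<Suc z. prod_encode (x, y) = z) = fst (prod_decode z)"
    "(LEAST y. \<exists>x<Suc z. prod_encode (x, y) = z) = snd (prod_decode z)" for z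
    by (rule Least_equality; use le[of z] in \<open>auto simp: pr\<close>)+
  moreover have "computable 1 (\<lambda>xs. LEAST x. \<exists>y<Suc (xs ! 0). prod_encode (x, y) = xs ! 0)"
    "computable 1 (\<lambda>xs. LEAST y. \<exists>x<Suc (xs ! 0). prod_encode (x, y) = xs ! 0)"
    by (intro computable_intros; use le in \<open>auto simp: pr\<close>)+
  ultimately show "computable n (\<lambda>xs. fst (prod_decode (f xs)))"
    "computable n (\<lambda>xs. snd (prod_decode (f xs)))"
    by (intro computable_comp1[OF _ assms]; simp)+
qed

section \<open>Access to coded lists\<close>

text \<open>A nonempty list is coded by the successor of the pair of its head and the code of its
  tail, so one step subtracts 1 and takes the second component.\<close>

definition code_drop :: "nat \<Rightarrow> nat \<Rightarrow> nat" where
  "code_drop c i = rec_nat c (\<lambda>k r. snd (prod_decode (r - 1))) i"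

definition code_nth :: "nat \<Rightarrow> nat \<Rightarrow> nat" where
  "code_nth c i = fst (prod_decode (code_drop c i - 1))"

definition code_length :: "nat \<Rightarrow> nat" where
  "code_length c = (LEAST i. code_drop c i = 0)"

lemma code_drop_list_encode: "code_drop (list_encode xs) i = list_encode (drop i xs)"
proof (induction i)
  case 0
  show ?case by (simp add: code_drop_def)
next
  case (Suc i)
  \<comment> \<open>Needed for the empty list: \<open>0 - 1\<close> is 0, so dropping from code 0
    gives 0 again.\<close>
  have "prod_decode 0 = (0, 0)"
    using prod_encode_inverse[of "(0, 0)"] by (simp add: prod_encode_def)
  then have tl: "snd (prod_decode (list_encode ys - 1)) = list_encode (tl ys)" for ys
    by (cases ys) auto
  show ?case
    using Suc by (simp add: code_drop_def tl drop_Suc tl_drop del: One_nat_def)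
qed

lemma list_encode_eq_0_iff [simp]: "list_encode xs = 0 \<longleftrightarrow> xs = []"
  by (cases xs) auto

lemma code_length_list_encode [simp]: "code_length (list_encode xs) = length xs"
  unfolding code_length_def code_drop_list_encode by (rule Least_equality) auto

lemma code_nth_list_encode [simp]: "i < length xs \<Longrightarrow> code_nth (list_encode xs) i = xs ! i"
  unfolding code_nth_def code_drop_list_encode by (cases "drop i xs") (auto simp: nth_via_drop)

lemma computable_code_drop [computable_intros]:
  assumes "computable n f" "computable n g"
  shows "computable n (\<lambda>xs. code_drop (f xs) (g xs))"
  by (rule computable_comp2[OF _ assms], unfold code_drop_def, intro computable_intros) simp_all

lemma computable_code_nth [computable_intros]:
  assumes "computable n f" "computable n g"
  shows "computable n (\<lambda>xs. code_nth (f xs) (g xs))"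
  unfolding code_nth_def using assms by (intro computable_intros)

lemma computable_code_length [computable_intros]:
  assumes "computable n f"
  shows "computable n (\<lambda>xs. code_length (f xs))"
proof -
  have ex: "\<exists>i. code_drop c i = 0" for c
    using code_drop_list_encode[of "list_decode c" "length (list_decode c)"] by auto
  show ?thesis
    by (rule computable_comp1[OF _ assms], unfold code_length_def, intro computable_intros)
      (simp_all add: ex)
qed

text \<open>Every number codes a list, so quantifying over entries is quantifying over positions
  below \<open>code_length\<close>.\<close>

lemma decidable_bex_list_decode [computable_intros]:
  assumes "computable n l" "decidable (Suc n) (\<lambda>ys. P (ys ! 0) (tl ys))"
  shows "decidable n (\<lambda>xs. \<exists>x\<in>set (list_decode (l xs)). P x xs)"
proof -
  have eq: "(\<exists>x\<in>set (list_decode c). Q x) \<longleftrightarrow> (\<exists>i<code_length c. Q (code_nth c i))" for c Q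
    using code_length_list_encode[of "list_decode c"] code_nth_list_encode[of _ "list_decode c"]
    by (auto simp: Bex_def in_set_conv_nth)
  have "computable (Suc n) (\<lambda>ys. code_nth (l (tl ys)) (ys ! 0))"
    using computable_drop[OF assms(1), of 1]
    by (intro computable_intros) (simp_all add: drop_Suc)
  then have "decidable (Suc n) (\<lambda>ys. P (code_nth (l (tl ys)) (ys ! 0)) (tl ys))"
    using computable_Cons_drop[OF assms(2)[unfolded decidable_def], of 1
        "\<lambda>ys. code_nth (l (tl ys)) (ys ! 0)"]
    by (simp add: decidable_def drop_Suc)
  then show ?thesis
    unfolding eq using assms(1) by (intro computable_intros)
qed

lemma decidable_ball_list_decode [computable_intros]:
  assumes "computable n l" "decidable (Suc n) (\<lambda>ys. P (ys ! 0) (tl ys))"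
  shows "decidable n (\<lambda>xs. \<forall>x\<in>set (list_decode (l xs)). P x xs)"
  using decidable_not[OF decidable_bex_list_decode[OF assms(1) decidable_not[OF assms(2)]]] by simp

lemma mem_le_list_encode: "x \<in> set xs \<Longrightarrow> x \<le> list_encode xs"
  by (induction xs)
    (auto intro: le_SucI le_prod_encode_1 order_trans[OF _ le_prod_encode_2])

text \<open>The code of the list of \<open>l\<close> copies of \<open>m\<close>, which dominates the
  codes of all lists of length at most \<open>l\<close> with entries at most
  \<open>m\<close>.\<close>

definition code_bound :: "nat \<Rightarrow> nat \<Rightarrow> nat" where
  "code_bound m l = rec_nat 0 (\<lambda>k r. Suc (prod_encode (m, r))) l"

lemma computable_code_bound [computable_intros]:
  assumes "computable n f" "computable n g"
  shows "computable n (\<lambda>xs. code_bound (f xs) (g xs))"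
  by (rule computable_comp2[OF _ assms], unfold code_bound_def, intro computable_intros) simp_all

lemma prod_encode_mono: "a \<le> a' \<Longrightarrow> b \<le> b' \<Longrightarrow> prod_encode (a, b) \<le> prod_encode (a', b')"
  unfolding prod_encode_def triangle_def by (auto intro!: add_mono div_le_mono mult_le_mono)

lemma list_encode_le_code_bound:
  assumes "length xs \<le> l" "\<And>x. x \<in> set xs \<Longrightarrow> x \<le> m"
  shows "list_encode xs \<le> code_bound m l"
  using assms
proof (induction xs arbitrary: l)
  case Nil
  show ?case by simp
next
  case (Cons x xs)
  then obtain l' where l': "l = Suc l'" "length xs \<le> l'" by (cases l) auto
  with Cons have "list_encode xs \<le> code_bound m l'" by simp
  then show ?case
    using Cons.prems l'(1) by (simp add: code_bound_def prod_encode_mono)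
qed


declare list_encode.simps [simp del]


section \<open>Short words suffice\<close>

lemma state_after_append: "state_after M q (u @ v) = state_after M (state_after M q u) v"
  by (induction u arbitrary: q) auto

lemma out_word_append: "out_word M q (u @ v) = out_word M q u @ out_word M (state_after M q u) v"
  by (induction u arbitrary: q) auto

lemma state_after_in_states:
  assumes "mealy_automaton M" "q \<in> states M" "u \<in> lists (alphabet M)"
  shows "state_after M q u \<in> states M"
  using assms(2,3) by (induction u arbitrary: q) (use assms(1) in \<open>auto simp: mealy_automaton_def\<close>)

lemma out_word_in_lists:
  assumes "mealy_automaton M" "q \<in> states M" "u \<in> lists (alphabet M)"
  shows "out_word M q u \<in> lists (alphabet M)"
  using assms(2,3) by (induction u arbitrary: q) (use assms(1) in \<open>auto simp: mealy_automaton_def\<close>)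

lemma state_after_out_word_in_states:
  assumes "mealy_automaton M" "x \<in> states M" "y \<in> states M" "u \<in> lists (alphabet M)"
  shows "state_after M y (out_word M x u) \<in> states M"
  by (intro state_after_in_states out_word_in_lists assms)

lemma synchronizing_states_nonempty: "synchronizing M \<Longrightarrow> states M \<noteq> {}"
  by (auto simp: synchronizing_def Syn_def states_after_def)

text \<open>The image of a nonempty state set is nonempty, so having one element means that
  \<open>u\<close> acts as a constant map.\<close>

lemma Syn_iff:
  assumes "states M \<noteq> {}"
  shows "u \<in> Syn M \<longleftrightarrow> u \<in> lists (alphabet M) \<and>
    (\<forall>x\<in>states M. \<forall>y\<in>states M. state_after M x u = state_after M y u)"
proof -
  have "card (states_after M u) = 1 \<longleftrightarrow>
      (\<forall>x\<in>states M. \<forall>y\<in>states M. state_after M x u = state_after M y u)"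
  proof
    assume "card (states_after M u) = 1"
    then obtain z where "states_after M u = {z}" by (auto simp: card_1_singleton_iff)
    then show "\<forall>x\<in>states M. \<forall>y\<in>states M. state_after M x u = state_after M y u"
      unfolding states_after_def by (metis imageI singletonD)
  next
    assume *: "\<forall>x\<in>states M. \<forall>y\<in>states M. state_after M x u = state_after M y u"
    obtain x where "x \<in> states M" using assms by blast
    with * have "states_after M u = {state_after M x u}"
      unfolding states_after_def by blast
    then show "card (states_after M u) = 1" by simp
  qed
  then show ?thesis by (simp add: Syn_def)
qed

text \<open>This map records all that matters about \<open>u\<close> for both problems, and the map of \<open>u @ v\<close> is the
  composition of those of \<open>u\<close> and \<open>v\<close>.\<close>

definition pair_action :: "('q, 'a) mealy \<Rightarrow> 'a list \<Rightarrow> 'q \<times> 'q \<Rightarrow> 'q \<times> 'q" where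
  "pair_action M u = (\<lambda>(x, y)\<in>states M \<times> states M.
     (state_after M x u, state_after M y (out_word M x u)))"

lemma pair_action_in_funcset:
  assumes "mealy_automaton M" "u \<in> lists (alphabet M)"
  shows "pair_action M u \<in> states M \<times> states M \<rightarrow>\<^sub>E states M \<times> states M"
  using state_after_in_states[OF assms(1) _ assms(2)]
    state_after_out_word_in_states[OF assms(1) _ _ assms(2)]
  by (auto simp: pair_action_def)

text \<open>The output of \<open>u @ v\<close> from \<open>x\<close> is the output of
  \<open>u\<close> followed by that of \<open>v\<close> from the state reached by \<open>x\<close>
  under \<open>u\<close>; the second coordinate therefore continues from its value after
  \<open>u\<close>.\<close>

lemma pair_action_append:
  assumes "mealy_automaton M" "u \<in> lists (alphabet M)"
  shows "pair_action M (u @ v) = (\<lambda>z\<in>states M \<times> states M. pair_action M v (pair_action M u z))"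
proof (rule ext)
  fix z
  show "pair_action M (u @ v) z = (\<lambda>z\<in>states M \<times> states M. pair_action M v (pair_action M u z)) z"
    using state_after_in_states[OF assms(1) _ assms(2)]
      state_after_out_word_in_states[OF assms(1) _ _ assms(2)]
    by (auto simp: pair_action_def state_after_append out_word_append)
qed

text \<open>In a shortest word with a given action all prefixes act differently, since two prefixes
  with equal actions would allow the factor between them to be cut out.\<close>

lemma short_pair_action:
  fixes M :: "('q, 'a) mealy"
  assumes M: "mealy_automaton M" and u: "u \<in> lists (alphabet M)"
    and N: "N = (card (states M) * card (states M)) ^ (card (states M) * card (states M))"
  obtains v where "v \<in> lists (alphabet M)" "length v < N" "pair_action M v = pair_action M u"
proof -
  let ?P = "\<lambda>v. v \<in> lists (alphabet M) \<and> pair_action M v = pair_action M u"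
  have "?P u" using u by blast
  from ex_has_least_nat[of ?P, OF this, of length]
  obtain v where v: "v \<in> lists (alphabet M)" "pair_action M v = pair_action M u"
    and min: "\<And>w. w \<in> lists (alphabet M) \<Longrightarrow> pair_action M w = pair_action M u \<Longrightarrow> length v \<le> length w"
    by blast
  have fin: "finite (states M)" using M by (simp add: mealy_automaton_def)
  let ?S = "states M \<times> states M"
  have take: "take i v \<in> lists (alphabet M)" and drop: "drop i v \<in> lists (alphabet M)" for i
    using v(1) by (auto dest: in_set_takeD in_set_dropD)
  have "inj_on (\<lambda>i. pair_action M (take i v)) {..length v}"
  proof (rule linorder_inj_onI)
    fix i j assume ij: "i < j" "i \<in> {..length v}" "j \<in> {..length v}"
    show "pair_action M (take i v) \<noteq> pair_action M (take j v)"
    proof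
      assume "pair_action M (take i v) = pair_action M (take j v)"
      then have "pair_action M (take i v @ drop j v) = pair_action M (take j v @ drop j v)"
        using take by (simp only: pair_action_append[OF M])
      then have "length v \<le> length (take i v @ drop j v)"
        using take drop v by (intro min) auto
      then show False using ij by simp
    qed
  qed auto
  \<comment> \<open>There are \<open>length v + 1\<close> prefixes, the empty one included, which
    makes the bound on the length strict.\<close>
  then have "card {..length v} \<le> card (?S \<rightarrow>\<^sub>E ?S)"
    using pair_action_in_funcset[OF M take] fin
    by (intro card_inj_on_le[where f = "\<lambda>i. pair_action M (take i v)"]) (auto intro: finite_PiE)
  also have "card (?S \<rightarrow>\<^sub>E ?S) = N"
    using fin by (simp add: N card_PiE card_cartesian_product)
  finally show thesis using that v by auto
qed


section \<open>The decision procedures\<close>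

text \<open>The minimum runs over a condition that holds from the length of the table on, so that it
  exists on junk codes too.\<close>

definition code_row :: "nat \<Rightarrow> nat \<Rightarrow> nat \<Rightarrow> nat" where
  "code_row c q a = code_nth (code_nth c 2)
     (LEAST k. code_length (code_nth c 2) \<le> k \<or>
        code_nth (code_nth (code_nth c 2) k) 0 = q \<and> code_nth (code_nth (code_nth c 2) k) 1 = a)"

definition code_trans :: "nat \<Rightarrow> nat \<Rightarrow> nat \<Rightarrow> nat" where
  "code_trans c q a = code_nth (code_row c q a) 2"

definition code_out :: "nat \<Rightarrow> nat \<Rightarrow> nat \<Rightarrow> nat" where
  "code_out c q a = code_nth (code_row c q a) 3"

text \<open>The recursion runs over the length \<open>i\<close> of a prefix, matching the equations
  for appending a last letter.\<close>

definition code_run :: "nat \<Rightarrow> nat \<Rightarrow> nat \<Rightarrow> nat \<Rightarrow> nat" where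
  "code_run c q w i = rec_nat q (\<lambda>k r. code_trans c r (code_nth w k)) i"

text \<open>The second coordinate of \<open>pair_action\<close>: the output letters of the run from
  \<open>x\<close> are fed one by one to the run from \<open>y\<close>, without forming the output
  word.\<close>

definition code_run_out :: "nat \<Rightarrow> nat \<Rightarrow> nat \<Rightarrow> nat \<Rightarrow> nat \<Rightarrow> nat" where
  "code_run_out c x y w i =
     rec_nat y (\<lambda>k r. code_trans c r (code_out c (code_run c x w k) (code_nth w k))) i"

definition code_syn :: "nat \<Rightarrow> nat \<Rightarrow> bool" where
  "code_syn c w \<longleftrightarrow>
     (\<forall>a\<in>set (list_decode w). \<exists>b\<in>set (list_decode (code_nth c 1)). a = b) \<and>
     (\<forall>x\<in>set (list_decode (code_nth c 0)). \<forall>y\<in>set (list_decode (code_nth c 0)).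
        code_run c x w (code_length w) = code_run c y w (code_length w))"

text \<open>The exponential is the number of self-maps of \<open>Q \<times> Q\<close>.\<close>

definition word_bound :: "nat \<Rightarrow> nat" where
  "word_bound c =
     (let n = code_length (code_nth c 0) in Suc (code_bound (code_nth c 1) ((n * n) ^ (n * n))))"

definition code_reset :: "nat \<Rightarrow> bool" where
  "code_reset c \<longleftrightarrow> \<not> (\<exists>w<word_bound c. code_syn c w \<and>
     (\<exists>x\<in>set (list_decode (code_nth c 0)). \<exists>y\<in>set (list_decode (code_nth c 0)).
        \<exists>z\<in>set (list_decode (code_nth c 0)).
          code_run_out c x y w (code_length w) \<noteq> code_run_out c x z w (code_length w)))"

definition code_same_state_fun :: "nat \<Rightarrow> nat \<Rightarrow> nat \<Rightarrow> bool" where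
  "code_same_state_fun c q p \<longleftrightarrow> \<not> (\<exists>w<word_bound c. code_syn c w \<and>
     (\<exists>x\<in>set (list_decode (code_nth c 0)).
        code_run_out c q x w (code_length w) \<noteq> code_run_out c p x w (code_length w)))"

section \<open>Computability of the procedures\<close>

lemma computable_code_row [computable_intros]:
  assumes "computable n f" "computable n g" "computable n h"
  shows "computable n (\<lambda>xs. code_row (f xs) (g xs) (h xs))"
  by (rule computable_comp3[OF _ assms], unfold code_row_def, intro computable_intros) auto

lemma computable_code_trans [computable_intros]:
  assumes "computable n f" "computable n g" "computable n h"
  shows "computable n (\<lambda>xs. code_trans (f xs) (g xs) (h xs))"
  unfolding code_trans_def using assms by (intro computable_intros)

lemma computable_code_out [computable_intros]:
  assumes "computable n f" "computable n g" "computable n h"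
  shows "computable n (\<lambda>xs. code_out (f xs) (g xs) (h xs))"
  unfolding code_out_def using assms by (intro computable_intros)

lemma computable_code_run [computable_intros]:
  assumes "computable n f" "computable n g" "computable n h" "computable n k"
  shows "computable n (\<lambda>xs. code_run (f xs) (g xs) (h xs) (k xs))"
  by (rule computable_comp4[OF _ assms], unfold code_run_def, intro computable_intros) simp_all

lemma computable_code_run_out [computable_intros]:
  assumes "computable n f" "computable n g" "computable n h" "computable n k" "computable n l"
  shows "computable n (\<lambda>xs. code_run_out (f xs) (g xs) (h xs) (k xs) (l xs))"
  by (rule computable_comp5[OF _ assms], unfold code_run_out_def, intro computable_intros) simp_all

lemma computable_word_bound [computable_intros]:
  assumes "computable n f" shows "computable n (\<lambda>xs. word_bound (f xs))"
  unfolding word_bound_def Let_def using assms by (intro computable_intros)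

lemma decidable_code_syn [computable_intros]:
  assumes "computable n f" "computable n g"
  shows "decidable n (\<lambda>xs. code_syn (f xs) (g xs))"
  unfolding decidable_def
  \<comment> \<open>The composition rules speak of functions, so decidability is unfolded for them
    and folded back for the quantifier rules.\<close>
  by (rule computable_comp2[OF _ assms], fold decidable_def, unfold code_syn_def,
      intro computable_intros) simp_all

lemma decidable_code_reset [computable_intros]:
  assumes "computable n f"
  shows "decidable n (\<lambda>xs. code_reset (f xs))"
  unfolding decidable_def
  by (rule computable_comp1[OF _ assms], fold decidable_def, unfold code_reset_def,
      intro computable_intros) simp_all

lemma decidable_code_same_state_fun [computable_intros]:
  assumes "computable n f" "computable n g" "computable n h"
  shows "decidable n (\<lambda>xs. code_same_state_fun (f xs) (g xs) (h xs))"
  unfolding decidable_def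
  by (rule computable_comp3[OF _ assms], fold decidable_def, unfold code_same_state_fun_def,
      intro computable_intros) simp_all

section \<open>Correctness on codes of automata\<close>

lemma code_nth_encode_mealy:
  "code_nth (encode_mealy M) 0 = list_encode (sorted_list_of_set (states M))"
  "code_nth (encode_mealy M) 1 = list_encode (sorted_list_of_set (alphabet M))"
  "code_nth (encode_mealy M) 2 = list_encode (map list_encode (mealy_rows M))"
  unfolding encode_mealy_def by simp_all

context
  fixes M :: "(nat, nat) mealy" and c :: nat
  assumes M: "mealy_automaton M" and c: "c = encode_mealy M"
begin

text \<open>The first two entries of a row determine the other two, so whichever matching row the
  search meets first is the right one.\<close>

lemma code_row_encode_mealy:
  assumes "q \<in> states M" "a \<in> alphabet M"
  shows "code_row c q a = list_encode [q, a, trans_fun M q a, out_fun M q a]"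
proof -
  let ?R = "mealy_rows M"
  let ?P = "\<lambda>k. length ?R \<le> k \<or> code_nth (code_nth (code_nth c 2) k) 0 = q \<and>
     code_nth (code_nth (code_nth c 2) k) 1 = a"
  have fin: "finite (states M)" "finite (alphabet M)"
    using M by (auto simp: mealy_automaton_def)
  have set: "set ?R = (\<lambda>(q, a). [q, a, trans_fun M q a, out_fun M q a]) ` (states M \<times> alphabet M)"
    using fin by (simp add: mealy_rows_def)
  have nth: "code_nth (code_nth c 2) k = list_encode (?R ! k)" if "k < length ?R" for k
    using that by (simp add: c code_nth_encode_mealy)
  obtain k where k: "k < length ?R" "?R ! k = [q, a, trans_fun M q a, out_fun M q a]"
    using set assms by (metis (mono_tags, lifting) SigmaI case_prod_conv image_eqI in_set_conv_nth)
  define l where "l = (LEAST k. ?P k)"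
  have Pk: "?P k" using k nth by simp
  \<comment> \<open>The row of \<open>(q, a)\<close> occurs at \<open>k\<close>, so the minimum lies
    inside the table and is a genuine match.\<close>
  have l: "?P l" "l < length ?R"
    using LeastI[of ?P, OF Pk] Least_le[of ?P, OF Pk] k(1) unfolding l_def by auto
  then have "?R ! l \<in> set ?R" by simp
  then obtain q' a' where row: "?R ! l = [q', a', trans_fun M q' a', out_fun M q' a']"
    unfolding set by auto
  then have "q' = q" "a' = a" using l nth[OF l(2)] by auto
  moreover have "code_row c q a = code_nth (code_nth c 2) l"
    unfolding code_row_def l_def by (simp add: c code_nth_encode_mealy)
  ultimately show ?thesis using row nth[OF l(2)] by simp
qed

lemma code_trans_encode_mealy:
  "q \<in> states M \<Longrightarrow> a \<in> alphabet M \<Longrightarrow> code_trans c q a = trans_fun M q a"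
  unfolding code_trans_def by (simp add: code_row_encode_mealy)

lemma code_out_encode_mealy:
  "q \<in> states M \<Longrightarrow> a \<in> alphabet M \<Longrightarrow> code_out c q a = out_fun M q a"
  unfolding code_out_def by (simp add: code_row_encode_mealy)

lemma code_run_encode_mealy:
  assumes q: "q \<in> states M" and u: "u \<in> lists (alphabet M)" and i: "i \<le> length u"
  shows "code_run c q (list_encode u) i = state_after M q (take i u)"
  using i
proof (induction i)
  case 0
  show ?case by (simp add: code_run_def)
next
  case (Suc i)
  have "take i u \<in> lists (alphabet M)" "u ! i \<in> alphabet M"
    using u Suc.prems by (auto dest: in_set_takeD)
  moreover have "code_run c q (list_encode u) (Suc i) =
      code_trans c (code_run c q (list_encode u) i) (code_nth (list_encode u) i)"
    by (simp add: code_run_def)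
  moreover have "code_run c q (list_encode u) i = state_after M q (take i u)"
    using Suc by simp
  ultimately show ?case
    using Suc.prems state_after_in_states[OF M q]
    by (simp only: take_Suc_conv_app_nth[OF Suc_le_lessD[OF Suc.prems]] state_after_append_letter
        code_trans_encode_mealy code_nth_list_encode[OF Suc_le_lessD[OF Suc.prems]])
qed

text \<open>Both current states stay in \<open>states M\<close> and the output letter stays in the
  alphabet, so every table lookup is a valid one.\<close>

lemma code_run_out_encode_mealy:
  assumes x: "x \<in> states M" and y: "y \<in> states M"
    and u: "u \<in> lists (alphabet M)" and i: "i \<le> length u"
  shows "code_run_out c x y (list_encode u) i = state_after M y (out_word M x (take i u))"
  using i
proof (induction i)
  case 0
  show ?case by (simp add: code_run_out_def)
next
  case (Suc i)
  let ?x = "state_after M x (take i u)" and ?y = "state_after M y (out_word M x (take i u))"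
  have ui: "take i u \<in> lists (alphabet M)" "u ! i \<in> alphabet M"
    using u Suc.prems by (auto dest: in_set_takeD)
  then have x': "?x \<in> states M" and y': "?y \<in> states M"
    using state_after_in_states[OF M] out_word_in_lists[OF M x] x y by auto
  moreover have "out_fun M ?x (u ! i) \<in> alphabet M"
    using M ui(2) x' by (auto simp: mealy_automaton_def)
  moreover have "code_run c x (list_encode u) i = ?x"
    using code_run_encode_mealy[OF x u] Suc.prems by simp
  moreover have "code_run_out c x y (list_encode u) i = ?y"
    using Suc by simp
  moreover have "code_run_out c x y (list_encode u) (Suc i) =
      code_trans c (code_run_out c x y (list_encode u) i)
        (code_out c (code_run c x (list_encode u) i) (code_nth (list_encode u) i))"
    by (simp add: code_run_out_def)
  ultimately show ?case
    using ui(2)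
    by (simp only: take_Suc_conv_app_nth[OF Suc_le_lessD[OF Suc.prems]] state_after_append_letter
        out_word_append_letter code_trans_encode_mealy code_out_encode_mealy
        code_nth_list_encode[OF Suc_le_lessD[OF Suc.prems]])
qed

lemma
  assumes "x \<in> states M" "y \<in> states M" "u \<in> lists (alphabet M)"
  shows code_run_pair_action: "code_run c x (list_encode u) (length u) = fst (pair_action M u (x, y))"
    and code_run_out_pair_action:
      "code_run_out c x y (list_encode u) (length u) = snd (pair_action M u (x, y))"
  using assms code_run_encode_mealy[of x u "length u"] code_run_out_encode_mealy[of x y u "length u"]
  by (simp_all add: pair_action_def)

lemma set_code_states: "set (list_decode (code_nth c 0)) = states M"
  and set_code_alphabet: "set (list_decode (code_nth c 1)) = alphabet M"
  using M by (simp_all add: c code_nth_encode_mealy mealy_automaton_def del: One_nat_def)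

text \<open>The first coordinate of the action ignores the second state, so diagonal pairs suffice.
  Hence words with equal actions are synchronizing together.\<close>

lemma Syn_iff_pair_action:
  assumes "states M \<noteq> {}" "u \<in> lists (alphabet M)"
  shows "u \<in> Syn M \<longleftrightarrow>
    (\<forall>x\<in>states M. \<forall>y\<in>states M. fst (pair_action M u (x, x)) = fst (pair_action M u (y, y)))"
  using assms by (simp add: Syn_iff pair_action_def)

lemma code_syn_encode_mealy:
  assumes "states M \<noteq> {}"
  shows "code_syn c (list_encode u) \<longleftrightarrow> u \<in> Syn M"
proof (cases "u \<in> lists (alphabet M)")
  case True
  have "(\<forall>x\<in>states M. \<forall>y\<in>states M. code_run c x (list_encode u) (length u) =
        code_run c y (list_encode u) (length u)) \<longleftrightarrow> u \<in> Syn M"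
    unfolding Syn_iff_pair_action[OF assms True]
    by (simp add: code_run_pair_action[where x = x and y = x for x, OF _ _ True])
  moreover have "\<forall>a\<in>set u. \<exists>b\<in>alphabet M. a = b"
    using True by auto
  ultimately show ?thesis
    unfolding code_syn_def set_code_states set_code_alphabet code_length_list_encode
      list_encode_inverse by blast
next
  case False
  then show ?thesis
    unfolding code_syn_def set_code_alphabet list_encode_inverse Syn_def by blast
qed

text \<open>Common core of both procedures: a test that depends only on the action of a word holds
  for some synchronizing word iff it holds for one whose code is below the bound.\<close>

lemma bounded_search:
  assumes "states M \<noteq> {}"
    and P: "\<And>u. u \<in> lists (alphabet M) \<Longrightarrow> P (list_encode u) \<longleftrightarrow> Q (pair_action M u)"
  shows "(\<exists>w<word_bound c. code_syn c w \<and> P w) \<longleftrightarrow> (\<exists>u\<in>Syn M. Q (pair_action M u))"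
proof
  assume "\<exists>w<word_bound c. code_syn c w \<and> P w"
  then obtain w where "code_syn c w" "P w" by blast
  then have "list_decode w \<in> Syn M" "P (list_encode (list_decode w))"
    using code_syn_encode_mealy[OF assms(1), of "list_decode w"] by auto
  then show "\<exists>u\<in>Syn M. Q (pair_action M u)"
    using P[of "list_decode w"] by (auto simp: Syn_def)
next
  assume "\<exists>u\<in>Syn M. Q (pair_action M u)"
  then obtain u where u: "u \<in> Syn M" "u \<in> lists (alphabet M)" "Q (pair_action M u)"
    by (auto simp: Syn_def)
  let ?n = "card (states M)"
  obtain v where v: "v \<in> lists (alphabet M)" "length v < (?n * ?n) ^ (?n * ?n)"
    "pair_action M v = pair_action M u"
    using short_pair_action[OF M u(2) refl] by blast
  have "v \<in> Syn M"
    using u(1) v(3) Syn_iff_pair_action[OF assms(1) u(2)] Syn_iff_pair_action[OF assms(1) v(1)]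
    by (simp only:)
  \<comment> \<open>Each letter is at most the code of the alphabet, which the procedure can read
    off its input.\<close>
  moreover have "list_encode v \<le> code_bound (code_nth c 1) ((?n * ?n) ^ (?n * ?n))"
  proof (rule list_encode_le_code_bound)
    fix a assume "a \<in> set v"
    then have "a \<in> set (list_decode (code_nth c 1))"
      using v(1) unfolding set_code_alphabet by auto
    then show "a \<le> code_nth c 1"
      using mem_le_list_encode by fastforce
  qed (use v in simp)
  moreover have "code_length (code_nth c 0) = ?n"
    using M by (simp add: c code_nth_encode_mealy mealy_automaton_def)
  ultimately have "list_encode v < word_bound c" "code_syn c (list_encode v)"
    by (simp_all add: word_bound_def Let_def code_syn_encode_mealy[OF assms(1)] del: One_nat_def)
  then show "\<exists>w<word_bound c. code_syn c w \<and> P w"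
    using P[OF v(1)] v(3) u(3) by auto
qed

text \<open>The output of \<open>u\<close> from \<open>x\<close> is synchronizing iff the second
  coordinate of the action of \<open>u\<close> at \<open>(x, y)\<close> does not depend on
  \<open>y\<close>.\<close>

lemma code_reset_encode_mealy:
  assumes "synchronizing M"
  shows "code_reset c \<longleftrightarrow> reset_mealy M"
proof -
  have S: "states M \<noteq> {}" using assms by (rule synchronizing_states_nonempty)
  have iff: "out_word M x u \<in> Syn M \<longleftrightarrow> (\<forall>y\<in>states M. \<forall>z\<in>states M.
      snd (pair_action M u (x, y)) = snd (pair_action M u (x, z)))"
    if "x \<in> states M" "u \<in> Syn M" for x u
  proof -
    have "out_word M x u \<in> lists (alphabet M)"
      using out_word_in_lists[OF M that(1)] that(2) by (simp add: Syn_def)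
    then show ?thesis
      using that(1) by (simp add: Syn_iff[OF S] pair_action_def)
  qed
  have "code_reset c \<longleftrightarrow> \<not> (\<exists>u\<in>Syn M. \<exists>x\<in>states M. \<exists>y\<in>states M. \<exists>z\<in>states M.
      snd (pair_action M u (x, y)) \<noteq> snd (pair_action M u (x, z)))"
    unfolding code_reset_def set_code_states
    by (subst bounded_search[where Q = "\<lambda>f. \<exists>x\<in>states M. \<exists>y\<in>states M. \<exists>z\<in>states M.
        snd (f (x, y)) \<noteq> snd (f (x, z))"]) (simp_all add: S code_run_out_pair_action)
  also have "\<dots> \<longleftrightarrow> (\<forall>x\<in>states M. \<forall>u\<in>Syn M. out_word M x u \<in> Syn M)"
    using iff by blast
  finally show ?thesis using assms by (auto simp: reset_mealy_def)
qed

text \<open>In a reset automaton the output of a synchronizing word is synchronizing, so running it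
  from any state \<open>x\<close> yields the value of the modified state function.\<close>

lemma code_same_state_fun_encode_mealy:
  assumes reset: "reset_mealy M" and q: "q \<in> states M" and p: "p \<in> states M"
  shows "code_same_state_fun c q p \<longleftrightarrow> modified_state_fun M q = modified_state_fun M p"
proof -
  have S: "states M \<noteq> {}"
    using reset by (intro synchronizing_states_nonempty) (simp add: reset_mealy_def)
  have val: "modified_state_fun M r u = state_after M x (out_word M r u)"
    if "u \<in> Syn M" "x \<in> states M" "r \<in> states M" for r u x
  proof -
    have "out_word M r u \<in> Syn M" using reset that by (auto simp: reset_mealy_def)
    then have "states_after M (out_word M r u) = {state_after M x (out_word M r u)}"
      using that(2) unfolding Syn_iff[OF S] states_after_def by blast
    then show ?thesis using that(1) by (simp add: modified_state_fun_def)
  qed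
  have "code_same_state_fun c q p \<longleftrightarrow> \<not> (\<exists>u\<in>Syn M. \<exists>x\<in>states M.
      snd (pair_action M u (q, x)) \<noteq> snd (pair_action M u (p, x)))"
    unfolding code_same_state_fun_def set_code_states
    by (subst bounded_search[where Q = "\<lambda>f. \<exists>x\<in>states M. snd (f (q, x)) \<noteq> snd (f (p, x))"])
      (simp_all add: S q p code_run_out_pair_action)
  also have "\<dots> \<longleftrightarrow> (\<forall>u\<in>Syn M. \<forall>x\<in>states M. modified_state_fun M q u = modified_state_fun M p u)"
    using q p by (simp add: val pair_action_def)
  also have "\<dots> \<longleftrightarrow> (\<forall>u\<in>Syn M. modified_state_fun M q u = modified_state_fun M p u)"
    using S by blast
  \<comment> \<open>Outside \<open>Syn M\<close> both restricted functions are
    \<open>undefined\<close>, so agreement on \<open>Syn M\<close> is equality.\<close>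
  also have "\<dots> \<longleftrightarrow> modified_state_fun M q = modified_state_fun M p"
    unfolding modified_state_fun_def by (auto simp: fun_eq_iff restrict_def)
  finally show ?thesis .
qed

end

section \<open>The two decision problems\<close>

lemma decidable_problemI:
  assumes "decidable 1 (\<lambda>xs. R (xs ! 0))" "\<And>x. x \<in> I \<Longrightarrow> R (enc x) \<longleftrightarrow> P x"
  shows "decidable_problem enc I P"
proof -
  obtain f where "recursive_fun 1 f" "\<And>xs. length xs = 1 \<Longrightarrow> f xs = (if R (xs ! 0) then 1 else 0)"
    using assms(1) unfolding decidable_def computable_def by blast
  then show ?thesis
    unfolding decidable_problem_def using assms(2) by (intro exI[of _ f]) auto
qed

theorem proposition2:
  "decidable_problem encode_mealy
     {M. mealy_automaton M \<and> invertible_mealy M \<and> synchronizing M}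
     reset_mealy
   \<and>
   decidable_problem encode_mealy_states
     {(M, q, p). mealy_automaton M \<and> invertible_mealy M \<and> reset_mealy M \<and>
        q \<in> states M \<and> p \<in> states M \<and> q \<noteq> p}
     (\<lambda>(M, q, p). modified_state_fun M q = modified_state_fun M p)"
proof
  show "decidable_problem encode_mealy
     {M. mealy_automaton M \<and> invertible_mealy M \<and> synchronizing M}
     reset_mealy"
  proof (rule decidable_problemI)
    show "decidable 1 (\<lambda>xs. code_reset (xs ! 0))"
      by (intro computable_intros) simp
  qed (simp add: code_reset_encode_mealy[OF _ refl])
  show "decidable_problem encode_mealy_states
     {(M, q, p). mealy_automaton M \<and> invertible_mealy M \<and> reset_mealy M \<and>
        q \<in> states M \<and> p \<in> states M \<and> q \<noteq> p}
     (\<lambda>(M, q, p). modified_state_fun M q = modified_state_fun M p)"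
  proof (rule decidable_problemI)
    show "decidable 1 (\<lambda>xs. code_same_state_fun (code_nth (xs ! 0) 0) (code_nth (xs ! 0) 1)
        (code_nth (xs ! 0) 2))"
      by (intro computable_intros) simp_all
  qed (auto simp: encode_mealy_states_def code_same_state_fun_encode_mealy[OF _ refl])
qed

end
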